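(* Let $A$ be a ring, $E$ a nonzero $A$-module, and let $R := A \propto E$ be the trivial ring extension of $A$ by $E$. (1) Assume that $E$ is a non-torsion $A$-module. Then $R$ is a valuation ring if and only if $A$ is a valuation domain and $E$ is isomorphic (as an $A$-module) to $K := \mathrm{qf}(A)$, the field of fractions of $A$. (2) Assume that $E$ is a finitely generated $A$-module. Then $R$ is a valuation ring if and only if $A$ is a field and $E \simeq A$ (as $A$-modules).
   Context: All rings are commutative with identity and all modules are unital. An $A$-module $E$ is uniserial if the set of its submodules is totally ordered by inclusion; equivalently, for all $x,y \in E$, $x \in Ay$ or $y \in Ax$. A ring $A$ is a valuation ring if $A$ is a uniserial $A$-module (zero divisors are allowed); a valuation domain is a valuation ring that is an integral domain. The trivial ring extension (idealization) $A \propto E$ is the set of pairs $(a,e)$ with $a \in A$, $e \in E$, with componentwise addition and multiplication $(a,e)(b,f) = (ab, af+be)$. An $A$-module $E$ is a torsion module if for every $u \in E$ there exists $0 \neq a \in A$ such that $au = 0$; $E$ is non-torsion if it is not a torsion module, i.e. there is $u \in E$ with $(0:u) = \{a \in A : au = 0\} = 0$. *)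

theory Defs
  imports "HOL-Algebra.Module"
begin

definition uniserial :: "('a, 'm) ring_scheme \<Rightarrow> ('a, 'b, 'n) module_scheme \<Rightarrow> bool"
  where "uniserial A E \<longleftrightarrow>
    (\<forall>N N'. submodule N A E \<longrightarrow> submodule N' A E \<longrightarrow> N \<subseteq> N' \<or> N' \<subseteq> N)"

definition self_module :: "('a, 'm) ring_scheme \<Rightarrow> ('a, 'a) module"
  where "self_module A =
    \<lparr>carrier = carrier A, mult = mult A, one = one A, zero = zero A, add = add A,
     smult = mult A\<rparr>"

definition valuation_ring :: "('a, 'm) ring_scheme \<Rightarrow> bool"
  where "valuation_ring A \<longleftrightarrow> cring A \<and> uniserial A (self_module A)"

definition valuation_domain :: "('a, 'm) ring_scheme \<Rightarrow> bool"
  where "valuation_domain A \<longleftrightarrow> valuation_ring A \<and> domain A"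

definition idealization ::
    "('a, 'm) ring_scheme \<Rightarrow> ('a, 'b, 'n) module_scheme \<Rightarrow> ('a \<times> 'b) ring"
  where "idealization A E =
    \<lparr>carrier = carrier A \<times> carrier E,
     mult = (\<lambda>(a, e) (b, f). (a \<otimes>\<^bsub>A\<^esub> b, a \<odot>\<^bsub>E\<^esub> f \<oplus>\<^bsub>E\<^esub> b \<odot>\<^bsub>E\<^esub> e)),
     one = (\<one>\<^bsub>A\<^esub>, \<zero>\<^bsub>E\<^esub>),
     zero = (\<zero>\<^bsub>A\<^esub>, \<zero>\<^bsub>E\<^esub>),
     add = (\<lambda>(a, e) (b, f). (a \<oplus>\<^bsub>A\<^esub> b, e \<oplus>\<^bsub>E\<^esub> f))\<rparr>"

definition torsion_module :: "('a, 'm) ring_scheme \<Rightarrow> ('a, 'b, 'n) module_scheme \<Rightarrow> bool"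
  where "torsion_module A E \<longleftrightarrow>
    (\<forall>u \<in> carrier E. \<exists>a \<in> carrier A. a \<noteq> \<zero>\<^bsub>A\<^esub> \<and> a \<odot>\<^bsub>E\<^esub> u = \<zero>\<^bsub>E\<^esub>)"

definition fin_gen_module :: "('a, 'm) ring_scheme \<Rightarrow> ('a, 'b, 'n) module_scheme \<Rightarrow> bool"
  where "fin_gen_module A E \<longleftrightarrow>
    (\<exists>S. finite S \<and> S \<subseteq> carrier E \<and>
      (\<forall>x \<in> carrier E. \<exists>c \<in> S \<rightarrow> carrier A. x = (\<Oplus>\<^bsub>E\<^esub>s\<in>S. c s \<odot>\<^bsub>E\<^esub> s)))"

definition module_hom ::
    "('a, 'm) ring_scheme \<Rightarrow> ('a, 'b, 'n) module_scheme \<Rightarrow> ('a, 'c, 'k) module_scheme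
      \<Rightarrow> ('b \<Rightarrow> 'c) set"
  where "module_hom A M N =
    {h \<in> carrier M \<rightarrow> carrier N.
      (\<forall>x \<in> carrier M. \<forall>y \<in> carrier M. h (x \<oplus>\<^bsub>M\<^esub> y) = h x \<oplus>\<^bsub>N\<^esub> h y) \<and>
      (\<forall>a \<in> carrier A. \<forall>x \<in> carrier M. h (a \<odot>\<^bsub>M\<^esub> x) = a \<odot>\<^bsub>N\<^esub> h x)}"

definition module_isomorphic ::
    "('a, 'm) ring_scheme \<Rightarrow> ('a, 'b, 'n) module_scheme \<Rightarrow> ('a, 'c, 'k) module_scheme \<Rightarrow> bool"
  where "module_isomorphic A M N \<longleftrightarrow>
    (\<exists>h \<in> module_hom A M N. bij_betw h (carrier M) (carrier N))"

definition frac_rel :: "('a, 'm) ring_scheme \<Rightarrow> (('a \<times> 'a) \<times> ('a \<times> 'a)) set"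
  where "frac_rel A =
    {((a, s), (b, t)). a \<in> carrier A \<and> s \<in> carrier A - {\<zero>\<^bsub>A\<^esub>} \<and>
      b \<in> carrier A \<and> t \<in> carrier A - {\<zero>\<^bsub>A\<^esub>} \<and> a \<otimes>\<^bsub>A\<^esub> t = b \<otimes>\<^bsub>A\<^esub> s}"

definition frac :: "('a, 'm) ring_scheme \<Rightarrow> 'a \<Rightarrow> 'a \<Rightarrow> ('a \<times> 'a) set"
  where "frac A a s = frac_rel A `` {(a, s)}"

(* The field of fractions of A, carrying both its ring structure and its A-module structure.
   It is meaningful only when A is a domain: otherwise frac_rel need not be transitive. *)
definition frac_field :: "('a, 'm) ring_scheme \<Rightarrow> ('a, ('a \<times> 'a) set) module"
  where "frac_field A =
    \<lparr>carrier = (carrier A \<times> (carrier A - {\<zero>\<^bsub>A\<^esub>})) // frac_rel A,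
     mult = (\<lambda>X Y. \<Union>(a, s)\<in>X. \<Union>(b, t)\<in>Y. frac A (a \<otimes>\<^bsub>A\<^esub> b) (s \<otimes>\<^bsub>A\<^esub> t)),
     one = frac A \<one>\<^bsub>A\<^esub> \<one>\<^bsub>A\<^esub>,
     zero = frac A \<zero>\<^bsub>A\<^esub> \<one>\<^bsub>A\<^esub>,
     add = (\<lambda>X Y. \<Union>(a, s)\<in>X. \<Union>(b, t)\<in>Y.
       frac A (a \<otimes>\<^bsub>A\<^esub> t \<oplus>\<^bsub>A\<^esub> b \<otimes>\<^bsub>A\<^esub> s) (s \<otimes>\<^bsub>A\<^esub> t)),
     smult = (\<lambda>c X. \<Union>(a, s)\<in>X. frac A (c \<otimes>\<^bsub>A\<^esub> a) s)\<rparr>"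

lemma (in cring) module_self_module: "module R (self_module R)"
proof (rule moduleI)
  show "abelian_group (self_module R)"
  proof (rule abelian_groupI)
    fix x assume "x \<in> carrier (self_module R)"
    then show "\<exists>y \<in> carrier (self_module R). y \<oplus>\<^bsub>self_module R\<^esub> x = \<zero>\<^bsub>self_module R\<^esub>"
      by (auto simp: self_module_def intro: bexI[of _ "\<ominus> x"] l_neg)
  qed (auto simp: self_module_def a_ac)
qed (auto simp: self_module_def l_distr r_distr m_assoc is_cring)

lemma (in module) cring_idealization: "cring (idealization R M)"
proof (rule cringI)
  show "abelian_group (idealization R M)"
  proof (rule abelian_groupI)
    fix x assume "x \<in> carrier (idealization R M)"
    then obtain a e where "x = (a, e)" "a \<in> carrier R" "e \<in> carrier M"
      by (auto simp: idealization_def)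
    then show "\<exists>y \<in> carrier (idealization R M).
        y \<oplus>\<^bsub>idealization R M\<^esub> x = \<zero>\<^bsub>idealization R M\<^esub>"
      by (intro bexI[of _ "(\<ominus> a, \<ominus>\<^bsub>M\<^esub> e)"])
        (auto simp: idealization_def R.l_neg M.l_neg)
  qed (auto simp: idealization_def R.a_ac M.a_ac)
  show "comm_monoid (idealization R M)"
  proof (rule comm_monoidI)
    fix x y z
    assume "x \<in> carrier (idealization R M)" "y \<in> carrier (idealization R M)"
      "z \<in> carrier (idealization R M)"
    then obtain a e b f c g where xyz: "x = (a, e)" "y = (b, f)" "z = (c, g)"
      and car: "a \<in> carrier R" "e \<in> carrier M" "b \<in> carrier R" "f \<in> carrier M"
        "c \<in> carrier R" "g \<in> carrier M"
      by (auto simp: idealization_def)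
    have "c \<odot>\<^bsub>M\<^esub> (a \<odot>\<^bsub>M\<^esub> f) = a \<odot>\<^bsub>M\<^esub> (c \<odot>\<^bsub>M\<^esub> f)" "c \<odot>\<^bsub>M\<^esub> (b \<odot>\<^bsub>M\<^esub> e) = b \<odot>\<^bsub>M\<^esub> (c \<odot>\<^bsub>M\<^esub> e)"
      using car by (metis smult_assoc1 R.m_comm)+
    then show "x \<otimes>\<^bsub>idealization R M\<^esub> y \<otimes>\<^bsub>idealization R M\<^esub> z =
        x \<otimes>\<^bsub>idealization R M\<^esub> (y \<otimes>\<^bsub>idealization R M\<^esub> z)"
      using car
      by (simp add: xyz idealization_def R.m_assoc smult_assoc1 smult_r_distr M.a_assoc)
  qed (auto simp: idealization_def R.m_comm M.a_comm)
qed (auto simp: idealization_def R.l_distr smult_l_distr smult_r_distr M.a_ac)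

context domain
begin

lemma equiv_frac_rel: "equiv (carrier R \<times> (carrier R - {\<zero>})) (frac_rel R)"
proof (rule equivI)
  show "frac_rel R \<subseteq> (carrier R \<times> (carrier R - {\<zero>})) \<times> carrier R \<times> (carrier R - {\<zero>})"
    by (auto simp: frac_rel_def)
  show "refl_on (carrier R \<times> (carrier R - {\<zero>})) (frac_rel R)"
    by (auto simp: frac_rel_def refl_on_def)
  show "sym (frac_rel R)"
    by (auto simp: frac_rel_def sym_def)
  show "trans (frac_rel R)"
  proof (rule transI)
    fix x y z
    assume xy: "(x, y) \<in> frac_rel R" and yz: "(y, z) \<in> frac_rel R"
    obtain a s b t c u where x: "x = (a, s)" and y: "y = (b, t)" and z: "z = (c, u)"
      by (metis surj_pair)
    have car: "a \<in> carrier R" "s \<in> carrier R" "b \<in> carrier R" "t \<in> carrier R"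
        "c \<in> carrier R" "u \<in> carrier R" "s \<noteq> \<zero>" "t \<noteq> \<zero>" "u \<noteq> \<zero>"
      and e: "a \<otimes> t = b \<otimes> s" "b \<otimes> u = c \<otimes> t"
      using xy yz by (auto simp: frac_rel_def x y z)
    have "t \<otimes> (a \<otimes> u) = (a \<otimes> t) \<otimes> u" using car by (simp add: m_ac)
    also have "\<dots> = (b \<otimes> u) \<otimes> s" unfolding e(1) using car by (simp add: m_ac)
    also have "\<dots> = t \<otimes> (c \<otimes> s)" unfolding e(2) using car by (simp add: m_ac)
    finally have "a \<otimes> u = c \<otimes> s" using car by (simp add: m_lcancel)
    then show "(x, z) \<in> frac_rel R" using car by (auto simp: frac_rel_def x z)
  qed
qed

lemma frac_eq_iff:
  assumes "a \<in> carrier R" "s \<in> carrier R - {\<zero>}" "b \<in> carrier R" "t \<in> carrier R - {\<zero>}"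
  shows "frac R a s = frac R b t \<longleftrightarrow> a \<otimes> t = b \<otimes> s"
  unfolding frac_def using assms
  by (subst eq_equiv_class_iff[OF equiv_frac_rel]) (auto simp: frac_rel_def)

lemma carrier_frac_field:
  "carrier (frac_field R) = {frac R a s |a s. a \<in> carrier R \<and> s \<in> carrier R - {\<zero>}}"
  by (auto simp: frac_field_def frac_def quotient_def)

lemma Union_frac:
  assumes "a \<in> carrier R" "s \<in> carrier R - {\<zero>}"
    and "\<And>b t. \<lbrakk>b \<in> carrier R; t \<in> carrier R - {\<zero>}; a \<otimes> t = b \<otimes> s\<rbrakk> \<Longrightarrow> f b t = f a s"
  shows "(\<Union>(b, t)\<in>frac R a s. f b t) = f a s"
proof (rule SUP_eq_const)
  show "frac R a s \<noteq> {}"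
    using assms(1,2) by (auto simp: frac_def frac_rel_def)
  show "(case p of (b, t) \<Rightarrow> f b t) = f a s" if "p \<in> frac R a s" for p
  proof (cases p)
    case (Pair b t)
    then have "b \<in> carrier R" "t \<in> carrier R - {\<zero>}" "a \<otimes> t = b \<otimes> s"
      using that by (auto simp: frac_def frac_rel_def)
    from assms(3)[OF this] show ?thesis unfolding Pair prod.case .
  qed
qed

lemma mult_frac_field:
  assumes "a \<in> carrier R" "s \<in> carrier R - {\<zero>}" "b \<in> carrier R" "t \<in> carrier R - {\<zero>}"
  shows "frac R a s \<otimes>\<^bsub>frac_field R\<^esub> frac R b t = frac R (a \<otimes> b) (s \<otimes> t)"
proof -
  have inner: "(\<Union>(b', t')\<in>frac R b t. frac R (a' \<otimes> b') (s' \<otimes> t')) = frac R (a' \<otimes> b) (s' \<otimes> t)"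
    if a': "a' \<in> carrier R" "s' \<in> carrier R - {\<zero>}" for a' s'
  proof (rule Union_frac[where f = "\<lambda>b' t'. frac R (a' \<otimes> b') (s' \<otimes> t')"])
    fix b' t' assume h: "b' \<in> carrier R" "t' \<in> carrier R - {\<zero>}" "b \<otimes> t' = b' \<otimes> t"
    have "(a' \<otimes> b') \<otimes> (s' \<otimes> t) = (a' \<otimes> s') \<otimes> (b' \<otimes> t)"
      using a' h(1,2) assms by (simp add: m_ac)
    also have "\<dots> = (a' \<otimes> b) \<otimes> (s' \<otimes> t')"
      unfolding h(3)[symmetric] using a' h(1,2) assms by (simp add: m_ac)
    finally show "frac R (a' \<otimes> b') (s' \<otimes> t') = frac R (a' \<otimes> b) (s' \<otimes> t)"
      using a' h(1,2) assms by (subst frac_eq_iff) (auto simp: integral_iff)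
  qed (use assms in auto)
  have "(\<Union>(a', s')\<in>frac R a s. \<Union>(b', t')\<in>frac R b t. frac R (a' \<otimes> b') (s' \<otimes> t')) =
      (\<Union>(b', t')\<in>frac R b t. frac R (a \<otimes> b') (s \<otimes> t'))"
  proof (rule Union_frac[where f = "\<lambda>a' s'. \<Union>(b', t')\<in>frac R b t. frac R (a' \<otimes> b') (s' \<otimes> t')"])
    fix a' s' assume h: "a' \<in> carrier R" "s' \<in> carrier R - {\<zero>}" "a \<otimes> s' = a' \<otimes> s"
    have "(a' \<otimes> b) \<otimes> (s \<otimes> t) = (a' \<otimes> s) \<otimes> (b \<otimes> t)"
      using h(1,2) assms by (simp add: m_ac)
    also have "\<dots> = (a \<otimes> b) \<otimes> (s' \<otimes> t)"
      unfolding h(3)[symmetric] using h(1,2) assms by (simp add: m_ac)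
    finally have "frac R (a' \<otimes> b) (s' \<otimes> t) = frac R (a \<otimes> b) (s \<otimes> t)"
      using h(1,2) assms by (subst frac_eq_iff) (auto simp: integral_iff)
    then show "(\<Union>(b', t')\<in>frac R b t. frac R (a' \<otimes> b') (s' \<otimes> t')) =
        (\<Union>(b', t')\<in>frac R b t. frac R (a \<otimes> b') (s \<otimes> t'))"
      by (simp add: inner[OF h(1,2)] inner[OF assms(1,2)])
  qed (use assms in auto)
  then show ?thesis by (simp add: frac_field_def inner[OF assms(1,2)])
qed

lemma add_frac_field:
  assumes "a \<in> carrier R" "s \<in> carrier R - {\<zero>}" "b \<in> carrier R" "t \<in> carrier R - {\<zero>}"
  shows "frac R a s \<oplus>\<^bsub>frac_field R\<^esub> frac R b t = frac R (a \<otimes> t \<oplus> b \<otimes> s) (s \<otimes> t)"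
proof -
  have inner: "(\<Union>(b', t')\<in>frac R b t. frac R (a' \<otimes> t' \<oplus> b' \<otimes> s') (s' \<otimes> t')) =
      frac R (a' \<otimes> t \<oplus> b \<otimes> s') (s' \<otimes> t)"
    if a': "a' \<in> carrier R" "s' \<in> carrier R - {\<zero>}" for a' s'
  proof (rule Union_frac[where f = "\<lambda>b' t'. frac R (a' \<otimes> t' \<oplus> b' \<otimes> s') (s' \<otimes> t')"])
    fix b' t' assume h: "b' \<in> carrier R" "t' \<in> carrier R - {\<zero>}" "b \<otimes> t' = b' \<otimes> t"
    have "(a' \<otimes> t' \<oplus> b' \<otimes> s') \<otimes> (s' \<otimes> t) =
        a' \<otimes> t' \<otimes> (s' \<otimes> t) \<oplus> (s' \<otimes> s') \<otimes> (b' \<otimes> t)"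
      using a' h(1,2) assms by (simp add: l_distr r_distr m_ac)
    also have "\<dots> = (a' \<otimes> t \<oplus> b \<otimes> s') \<otimes> (s' \<otimes> t')"
      unfolding h(3)[symmetric] using a' h(1,2) assms by (simp add: l_distr r_distr m_ac)
    finally show "frac R (a' \<otimes> t' \<oplus> b' \<otimes> s') (s' \<otimes> t') = frac R (a' \<otimes> t \<oplus> b \<otimes> s') (s' \<otimes> t)"
      using a' h(1,2) assms by (subst frac_eq_iff) (auto simp: integral_iff)
  qed (use assms in auto)
  have "(\<Union>(a', s')\<in>frac R a s. \<Union>(b', t')\<in>frac R b t. frac R (a' \<otimes> t' \<oplus> b' \<otimes> s') (s' \<otimes> t')) =
      (\<Union>(b', t')\<in>frac R b t. frac R (a \<otimes> t' \<oplus> b' \<otimes> s) (s \<otimes> t'))"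
  proof (rule Union_frac[where
        f = "\<lambda>a' s'. \<Union>(b', t')\<in>frac R b t. frac R (a' \<otimes> t' \<oplus> b' \<otimes> s') (s' \<otimes> t')"])
    fix a' s' assume h: "a' \<in> carrier R" "s' \<in> carrier R - {\<zero>}" "a \<otimes> s' = a' \<otimes> s"
    have "(a' \<otimes> t \<oplus> b \<otimes> s') \<otimes> (s \<otimes> t) =
        (a' \<otimes> s) \<otimes> (t \<otimes> t) \<oplus> b \<otimes> s' \<otimes> (s \<otimes> t)"
      using h(1,2) assms by (simp add: l_distr r_distr m_ac)
    also have "\<dots> = (a \<otimes> t \<oplus> b \<otimes> s) \<otimes> (s' \<otimes> t)"
      unfolding h(3)[symmetric] using h(1,2) assms by (simp add: l_distr r_distr m_ac)
    finally have "frac R (a' \<otimes> t \<oplus> b \<otimes> s') (s' \<otimes> t) = frac R (a \<otimes> t \<oplus> b \<otimes> s) (s \<otimes> t)"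
      using h(1,2) assms by (subst frac_eq_iff) (auto simp: integral_iff)
    then show "(\<Union>(b', t')\<in>frac R b t. frac R (a' \<otimes> t' \<oplus> b' \<otimes> s') (s' \<otimes> t')) =
        (\<Union>(b', t')\<in>frac R b t. frac R (a \<otimes> t' \<oplus> b' \<otimes> s) (s \<otimes> t'))"
      by (simp add: inner[OF h(1,2)] inner[OF assms(1,2)])
  qed (use assms in auto)
  then show ?thesis by (simp add: frac_field_def inner[OF assms(1,2)])
qed

lemma smult_frac_field:
  assumes "c \<in> carrier R" "a \<in> carrier R" "s \<in> carrier R - {\<zero>}"
  shows "c \<odot>\<^bsub>frac_field R\<^esub> frac R a s = frac R (c \<otimes> a) s"
proof -
  have "(\<Union>(a', s')\<in>frac R a s. frac R (c \<otimes> a') s') = frac R (c \<otimes> a) s"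
  proof (rule Union_frac[where f = "\<lambda>a' s'. frac R (c \<otimes> a') s'"])
    fix a' s' assume h: "a' \<in> carrier R" "s' \<in> carrier R - {\<zero>}" "a \<otimes> s' = a' \<otimes> s"
    then have "(c \<otimes> a') \<otimes> s = (c \<otimes> a) \<otimes> s'"
      using assms by (simp add: m_assoc)
    then show "frac R (c \<otimes> a') s' = frac R (c \<otimes> a) s"
      using h(1,2) assms by (subst frac_eq_iff) auto
  qed (use assms in auto)
  then show ?thesis by (simp add: frac_field_def)
qed

lemma zero_frac_field: "\<zero>\<^bsub>frac_field R\<^esub> = frac R \<zero> \<one>"
  and one_frac_field: "\<one>\<^bsub>frac_field R\<^esub> = frac R \<one> \<one>"
  by (simp_all add: frac_field_def)

lemma in_frac_field:
  assumes "a \<in> carrier R" "s \<in> carrier R" "s \<noteq> \<zero>"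
  shows "frac R a s \<in> carrier (frac_field R)"
  using assms by (auto simp: carrier_frac_field)

lemmas frac_field_ops = mult_frac_field add_frac_field smult_frac_field
  zero_frac_field one_frac_field

lemma algebra_frac_field: "algebra R (frac_field R)"
(is "algebra R ?K")
proof (rule algebraI)
  show "cring R" by (rule is_cring)
  have K: "cring ?K"
  proof (rule cringI)
    show "abelian_group ?K"
    proof (rule abelian_groupI)
      fix x assume "x \<in> carrier ?K"
      then obtain a s where x: "x = frac R a s" "a \<in> carrier R" "s \<in> carrier R" "s \<noteq> \<zero>"
        by (auto simp: carrier_frac_field)
      then have "frac R (\<ominus> a) s \<oplus>\<^bsub>?K\<^esub> x = \<zero>\<^bsub>?K\<^esub>"
        by (simp add: frac_field_ops frac_eq_iff integral_iff l_minus l_neg)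
      then show "\<exists>y \<in> carrier ?K. y \<oplus>\<^bsub>?K\<^esub> x = \<zero>\<^bsub>?K\<^esub>"
        using x in_frac_field[of "\<ominus> a" s] by auto
    qed (auto simp: carrier_frac_field frac_field_ops integral_iff frac_eq_iff
        l_distr r_distr m_ac a_ac intro!: in_frac_field[unfolded carrier_frac_field, simplified])
    show "comm_monoid ?K"
      by (rule comm_monoidI)
        (auto simp: carrier_frac_field frac_field_ops integral_iff frac_eq_iff
        m_ac intro!: in_frac_field[unfolded carrier_frac_field, simplified])
  next
    fix x y z assume "x \<in> carrier ?K" "y \<in> carrier ?K" "z \<in> carrier ?K"
    then obtain a s b t c u where xyz: "x = frac R a s" "y = frac R b t" "z = frac R c u"
      and car: "a \<in> carrier R" "s \<in> carrier R" "s \<noteq> \<zero>" "b \<in> carrier R" "t \<in> carrier R"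
        "t \<noteq> \<zero>" "c \<in> carrier R" "u \<in> carrier R" "u \<noteq> \<zero>"
      by (auto simp: carrier_frac_field)
    have "frac R ((a \<otimes> t \<oplus> b \<otimes> s) \<otimes> c) (s \<otimes> t \<otimes> u) =
        frac R (a \<otimes> c \<otimes> (t \<otimes> u) \<oplus> b \<otimes> c \<otimes> (s \<otimes> u)) (s \<otimes> u \<otimes> (t \<otimes> u))"
      using car by (subst frac_eq_iff) (auto simp: integral_iff l_distr r_distr m_ac)
    then show "(x \<oplus>\<^bsub>?K\<^esub> y) \<otimes>\<^bsub>?K\<^esub> z = x \<otimes>\<^bsub>?K\<^esub> z \<oplus>\<^bsub>?K\<^esub> y \<otimes>\<^bsub>?K\<^esub> z"
      using car by (simp add: xyz frac_field_ops integral_iff)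
  qed
  show "cring ?K" by (rule K)
  fix a b x assume "a \<in> carrier R" "b \<in> carrier R" "x \<in> carrier ?K"
  then obtain c u where x: "x = frac R c u"
    and car: "a \<in> carrier R" "b \<in> carrier R" "c \<in> carrier R" "u \<in> carrier R" "u \<noteq> \<zero>"
    by (auto simp: carrier_frac_field)
  have "frac R ((a \<oplus> b) \<otimes> c) u = frac R (a \<otimes> c \<otimes> u \<oplus> b \<otimes> c \<otimes> u) (u \<otimes> u)"
    using car by (subst frac_eq_iff) (auto simp: integral_iff l_distr r_distr m_ac)
  then show "(a \<oplus> b) \<odot>\<^bsub>?K\<^esub> x = a \<odot>\<^bsub>?K\<^esub> x \<oplus>\<^bsub>?K\<^esub> b \<odot>\<^bsub>?K\<^esub> x"
    using car by (simp add: x frac_field_ops)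
  fix a x y assume "a \<in> carrier R" "x \<in> carrier ?K" "y \<in> carrier ?K"
  then show "a \<odot>\<^bsub>?K\<^esub> (x \<oplus>\<^bsub>?K\<^esub> y) = a \<odot>\<^bsub>?K\<^esub> x \<oplus>\<^bsub>?K\<^esub> a \<odot>\<^bsub>?K\<^esub> y"
    by (auto simp: carrier_frac_field frac_field_ops integral_iff r_distr m_assoc)
next
  fix a x assume "a \<in> carrier R" "x \<in> carrier ?K"
  then show "a \<odot>\<^bsub>?K\<^esub> x \<in> carrier ?K"
    by (subst (asm) carrier_frac_field) (auto simp: smult_frac_field intro!: in_frac_field)
next
  fix a x y assume "a \<in> carrier R" "x \<in> carrier ?K" "y \<in> carrier ?K"
  moreover from this obtain b t c u where "x = frac R b t" "y = frac R c u"
    "b \<in> carrier R" "t \<in> carrier R" "t \<noteq> \<zero>" "c \<in> carrier R" "u \<in> carrier R" "u \<noteq> \<zero>"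
    by (auto simp: carrier_frac_field)
  ultimately show "a \<odot>\<^bsub>?K\<^esub> x \<otimes>\<^bsub>?K\<^esub> y = a \<odot>\<^bsub>?K\<^esub> (x \<otimes>\<^bsub>?K\<^esub> y)"
    by (simp add: frac_field_ops integral_iff m_assoc)
qed (auto simp: carrier_frac_field smult_frac_field m_assoc)

lemma field_frac_field: "field (frac_field R)"
proof -
  interpret K: cring "frac_field R"
    by (rule algebra.M_cring[OF algebra_frac_field])
  show ?thesis
  proof (rule K.cring_fieldI2)
    show "\<zero>\<^bsub>frac_field R\<^esub> \<noteq> \<one>\<^bsub>frac_field R\<^esub>"
      by (simp add: frac_field_ops frac_eq_iff)
    fix x assume "x \<in> carrier (frac_field R)" "x \<noteq> \<zero>\<^bsub>frac_field R\<^esub>"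
    then obtain a s where x: "x = frac R a s" "a \<in> carrier R" "s \<in> carrier R" "s \<noteq> \<zero>"
      by (auto simp: carrier_frac_field)
    then have a: "a \<noteq> \<zero>"
      using \<open>x \<noteq> \<zero>\<^bsub>frac_field R\<^esub>\<close> by (auto simp: zero_frac_field frac_eq_iff)
    then have "x \<otimes>\<^bsub>frac_field R\<^esub> frac R s a = \<one>\<^bsub>frac_field R\<^esub>"
      using x by (simp add: frac_field_ops frac_eq_iff integral_iff m_comm)
    then show "\<exists>y \<in> carrier (frac_field R). x \<otimes>\<^bsub>frac_field R\<^esub> y = \<one>\<^bsub>frac_field R\<^esub>"
      using x a in_frac_field[of s a] by auto
  qed
qed

end

end

theory Submission
  imports Defs
begin

text \<open>
  Comparing \<open>(a, 0)\<close> with \<open>(0, e)\<close> for \<open>a \<noteq> 0\<close> in \<open>A \<propto> E\<close>, only \<open>(0, e) \<in> R (a, 0)\<close> is possible, so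
  \<open>E = aE\<close>. Hence \<open>A \<propto> E\<close> is a valuation ring iff \<open>A\<close> is a valuation domain and \<open>E\<close> is uniserial
  and divisible. If moreover \<open>u \<in> E\<close> has zero annihilator, every \<open>x \<in> E\<close> satisfies \<open>s x = a u\<close> for
  some \<open>s \<noteq> 0\<close>, and \<open>x \<mapsto> a/s\<close> is the isomorphism with the field of fractions. If \<open>E\<close> is finitely
  generated, it is cyclic, \<open>E = Au\<close>; then \<open>u \<in> aAu\<close> for each \<open>a \<noteq> 0\<close> yields \<open>c\<close> with
  \<open>(1 - ac) u = 0\<close>, and divisibility by \<open>1 - ac\<close> would force \<open>u = 0\<close> unless \<open>ac = 1\<close>.
\<close>

text \<open>Every nonzero scalar must act surjectively, zero divisors included. With this strong
  form, a ring that has a nonzero divisible module is a domain.\<close>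

definition divisible_module :: "('a, 'm) ring_scheme \<Rightarrow> ('a, 'b, 'n) module_scheme \<Rightarrow> bool"
  where "divisible_module A E \<longleftrightarrow>
    (\<forall>a \<in> carrier A - {\<zero>\<^bsub>A\<^esub>}. \<forall>x \<in> carrier E. \<exists>y \<in> carrier E. x = a \<odot>\<^bsub>E\<^esub> y)"

lemma divisible_moduleD:
  assumes "divisible_module A E" "a \<in> carrier A" "a \<noteq> \<zero>\<^bsub>A\<^esub>" "x \<in> carrier E"
  obtains y where "y \<in> carrier E" "x = a \<odot>\<^bsub>E\<^esub> y"
  using assms by (auto simp: divisible_module_def)

lemma self_module_simps [simp]:
  "carrier (self_module A) = carrier A" "add (self_module A) = add A"
  "zero (self_module A) = zero A" "smult (self_module A) = mult A"
  by (simp_all add: self_module_def)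

lemma idealization_simps [simp]:
  "carrier (idealization A E) = carrier A \<times> carrier E"
  "(a, e) \<otimes>\<^bsub>idealization A E\<^esub> (b, f) = (a \<otimes>\<^bsub>A\<^esub> b, a \<odot>\<^bsub>E\<^esub> f \<oplus>\<^bsub>E\<^esub> b \<odot>\<^bsub>E\<^esub> e)"
  by (simp_all add: idealization_def)

lemma (in abelian_group) minus_eq_zero_iff:
  assumes "x \<in> carrier G" "y \<in> carrier G"
  shows "x \<ominus> y = \<zero> \<longleftrightarrow> x = y"
  using assms by (metis minus_eq add.inv_closed minus_equality minus_minus r_neg)

section \<open>Uniserial modules: comparable elements and cyclic submodules\<close>

context module
begin

lemma submodule_cyclic:
  assumes x: "x \<in> carrier M"
  shows "submodule ((\<lambda>a. a \<odot>\<^bsub>M\<^esub> x) ` carrier R) R M"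
proof (rule submoduleI)
  show "\<zero>\<^bsub>M\<^esub> \<in> (\<lambda>a. a \<odot>\<^bsub>M\<^esub> x) ` carrier R"
    by (rule image_eqI[of _ _ \<zero>]) (simp_all add: x)
next
  fix y assume "y \<in> (\<lambda>a. a \<odot>\<^bsub>M\<^esub> x) ` carrier R"
  then show "\<ominus>\<^bsub>M\<^esub> y \<in> (\<lambda>a. a \<odot>\<^bsub>M\<^esub> x) ` carrier R"
    using x by (auto simp: smult_l_minus[symmetric])
next
  fix y z assume "y \<in> (\<lambda>a. a \<odot>\<^bsub>M\<^esub> x) ` carrier R" "z \<in> (\<lambda>a. a \<odot>\<^bsub>M\<^esub> x) ` carrier R"
  then show "y \<oplus>\<^bsub>M\<^esub> z \<in> (\<lambda>a. a \<odot>\<^bsub>M\<^esub> x) ` carrier R"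
    using x by (auto simp: smult_l_distr[symmetric])
next
  fix a y assume "a \<in> carrier R" "y \<in> (\<lambda>a. a \<odot>\<^bsub>M\<^esub> x) ` carrier R"
  then show "a \<odot>\<^bsub>M\<^esub> y \<in> (\<lambda>a. a \<odot>\<^bsub>M\<^esub> x) ` carrier R"
    using x by (auto simp: smult_assoc1[symmetric])
qed (use x in auto)

text \<open>One direction compares the cyclic submodules of \<open>x\<close> and \<open>y\<close>.
  Conversely, if \<open>N\<close> and \<open>N'\<close> were incomparable, take one element in each
  that misses the other; whichever is a multiple of the other lies in both submodules, a
  contradiction.\<close>

lemma uniserial_iff:
  "uniserial R M \<longleftrightarrow> (\<forall>x \<in> carrier M. \<forall>y \<in> carrier M.
    (\<exists>a \<in> carrier R. x = a \<odot>\<^bsub>M\<^esub> y) \<or> (\<exists>a \<in> carrier R. y = a \<odot>\<^bsub>M\<^esub> x))"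
    (is "_ \<longleftrightarrow> ?C")
proof
  assume uni: "uniserial R M"
  show ?C
  proof (intro ballI)
    fix x y assume x: "x \<in> carrier M" and y: "y \<in> carrier M"
    have gen: "z \<in> (\<lambda>a. a \<odot>\<^bsub>M\<^esub> z) ` carrier R" if "z \<in> carrier M" for z
      using that by (intro image_eqI[of _ _ \<one>]) auto
    have "(\<lambda>a. a \<odot>\<^bsub>M\<^esub> x) ` carrier R \<subseteq> (\<lambda>a. a \<odot>\<^bsub>M\<^esub> y) ` carrier R \<or>
        (\<lambda>a. a \<odot>\<^bsub>M\<^esub> y) ` carrier R \<subseteq> (\<lambda>a. a \<odot>\<^bsub>M\<^esub> x) ` carrier R"
      using uni submodule_cyclic[OF x] submodule_cyclic[OF y] unfolding uniserial_def by blast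
    then show "(\<exists>a \<in> carrier R. x = a \<odot>\<^bsub>M\<^esub> y) \<or> (\<exists>a \<in> carrier R. y = a \<odot>\<^bsub>M\<^esub> x)"
      using gen[OF x] gen[OF y] by blast
  qed
next
  assume C: ?C
  show "uniserial R M"
    unfolding uniserial_def
  proof (intro allI impI)
    fix N N' assume N: "submodule N R M" and N': "submodule N' R M"
    show "N \<subseteq> N' \<or> N' \<subseteq> N"
    proof (rule ccontr)
      assume "\<not> ?thesis"
      then obtain x y where xy: "x \<in> N" "x \<notin> N'" "y \<in> N'" "y \<notin> N" by blast
      then have "x \<in> carrier M" "y \<in> carrier M"
        using submoduleE(1)[OF N] submoduleE(1)[OF N'] by auto
      with C xy submoduleE(4)[OF N] submoduleE(4)[OF N'] show False by metis
    qed
  qed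
qed

lemma uniserialD:
  assumes "uniserial R M" "x \<in> carrier M" "y \<in> carrier M"
  obtains a where "a \<in> carrier R" "x = a \<odot>\<^bsub>M\<^esub> y" | a where "a \<in> carrier R" "y = a \<odot>\<^bsub>M\<^esub> x"
  using assms unfolding uniserial_iff by blast

text \<open>Induction on \<open>S\<close>: the new element \<open>x\<close> and the generator
  \<open>u\<close> found so far are comparable, and the one of which the other is a multiple
  generates both.\<close>

lemma uniserial_finite_generator:
  assumes uni: "uniserial R M" and S: "finite S" "S \<subseteq> carrier M"
  shows "\<exists>u \<in> carrier M. S \<subseteq> (\<lambda>a. a \<odot>\<^bsub>M\<^esub> u) ` carrier R"
  using S
proof (induction S)
  case empty
  then show ?case by (auto intro: bexI[of _ "\<zero>\<^bsub>M\<^esub>"])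
next
  case (insert x S)
  then obtain u where u: "u \<in> carrier M" and S: "S \<subseteq> (\<lambda>a. a \<odot>\<^bsub>M\<^esub> u) ` carrier R" by auto
  have x: "x \<in> carrier M" using insert.prems by simp
  from uni x u show ?case
  proof (cases rule: uniserialD)
    case (1 a)
    then show ?thesis using u S by blast
  next
    case (2 b)
    have "insert x S \<subseteq> (\<lambda>a. a \<odot>\<^bsub>M\<^esub> x) ` carrier R"
    proof
      fix y assume "y \<in> insert x S"
      then consider "y = \<one> \<odot>\<^bsub>M\<^esub> x" | a where "a \<in> carrier R" "y = a \<odot>\<^bsub>M\<^esub> u"
        using S x by auto
      then show "y \<in> (\<lambda>a. a \<odot>\<^bsub>M\<^esub> x) ` carrier R"
      proof cases
        case (2 a)
        then have "y = (a \<otimes> b) \<odot>\<^bsub>M\<^esub> x"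
          using \<open>b \<in> carrier R\<close> \<open>u = b \<odot>\<^bsub>M\<^esub> x\<close> x by (simp add: smult_assoc1)
        then show ?thesis using 2 \<open>b \<in> carrier R\<close> by blast
      qed blast
    qed
    then show ?thesis using x by blast
  qed
qed

text \<open>The finitely many generators lie in one cyclic submodule, which is closed under the
  linear combinations that make up the whole module.\<close>

lemma uniserial_fin_gen_cyclic:
  assumes uni: "uniserial R M" and fg: "fin_gen_module R M"
  obtains u where "u \<in> carrier M" "carrier M = (\<lambda>a. a \<odot>\<^bsub>M\<^esub> u) ` carrier R"
proof -
  from fg obtain S where S: "finite S" "S \<subseteq> carrier M"
    and gen: "\<And>x. x \<in> carrier M \<Longrightarrow> \<exists>c \<in> S \<rightarrow> carrier R. x = (\<Oplus>\<^bsub>M\<^esub>s\<in>S. c s \<odot>\<^bsub>M\<^esub> s)"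
    unfolding fin_gen_module_def by blast
  from uniserial_finite_generator[OF uni S] obtain u
    where u: "u \<in> carrier M" and Su: "S \<subseteq> (\<lambda>a. a \<odot>\<^bsub>M\<^esub> u) ` carrier R" by blast
  note cyc = submoduleE[OF submodule_cyclic[OF u]]
  have fin: "(\<Oplus>\<^bsub>M\<^esub>s\<in>T. f s) \<in> (\<lambda>a. a \<odot>\<^bsub>M\<^esub> u) ` carrier R"
    if "finite T" "f \<in> T \<rightarrow> (\<lambda>a. a \<odot>\<^bsub>M\<^esub> u) ` carrier R" for T :: "'c set" and f
    using that
  proof (induction T)
    case empty
    show ?case by (rule image_eqI[of _ _ \<zero>]) (simp_all add: u)
  next
    case (insert s T)
    then have "f \<in> T \<rightarrow> carrier M" "f s \<in> carrier M" using cyc(1) by blast+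
    then have "(\<Oplus>\<^bsub>M\<^esub>s\<in>insert s T. f s) = f s \<oplus>\<^bsub>M\<^esub> (\<Oplus>\<^bsub>M\<^esub>s\<in>T. f s)"
      using insert.hyps by simp
    also have "\<dots> \<in> (\<lambda>a. a \<odot>\<^bsub>M\<^esub> u) ` carrier R"
      using insert by (intro cyc(5)) auto
    finally show ?case .
  qed
  have "carrier M \<subseteq> (\<lambda>a. a \<odot>\<^bsub>M\<^esub> u) ` carrier R"
  proof
    fix x assume "x \<in> carrier M"
    then obtain c where c: "c \<in> S \<rightarrow> carrier R" and x: "x = (\<Oplus>\<^bsub>M\<^esub>s\<in>S. c s \<odot>\<^bsub>M\<^esub> s)"
      using gen by blast
    show "x \<in> (\<lambda>a. a \<odot>\<^bsub>M\<^esub> u) ` carrier R"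
      unfolding x using S(1) c Su by (intro fin Pi_I cyc(4)) auto
  qed
  with u show thesis by (intro that[of u]) auto
qed

section \<open>When the idealization is a valuation ring\<close>

lemma valuation_ring_idealizationD:
  assumes nz: "carrier M \<noteq> {\<zero>\<^bsub>M\<^esub>}" and val: "valuation_ring (idealization R M)"
  shows "valuation_domain R" "uniserial R M" "divisible_module R M"
proof -
  interpret I: module "idealization R M" "self_module (idealization R M)"
    by (rule cring.module_self_module[OF cring_idealization])
  interpret S: module R "self_module R" by (rule module_self_module)
  have uni: "uniserial (idealization R M) (self_module (idealization R M))"
    using val by (simp add: valuation_ring_def)
  \<comment> \<open>The multiplier is written out as a pair \<open>(c, g)\<close>. Each conclusion
    below comes from a suitable choice of the two pairs to compare.\<close>
  have cmp: "(\<exists>c \<in> carrier R. \<exists>g \<in> carrier M. (a, e) = (c \<otimes> b, c \<odot>\<^bsub>M\<^esub> f \<oplus>\<^bsub>M\<^esub> b \<odot>\<^bsub>M\<^esub> g)) \<or>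
      (\<exists>c \<in> carrier R. \<exists>g \<in> carrier M. (b, f) = (c \<otimes> a, c \<odot>\<^bsub>M\<^esub> e \<oplus>\<^bsub>M\<^esub> a \<odot>\<^bsub>M\<^esub> g))"
    if "a \<in> carrier R" "b \<in> carrier R" "e \<in> carrier M" "f \<in> carrier M" for a b e f
    using uni that unfolding I.uniserial_iff by simp
  show uniM: "uniserial R M"
    unfolding uniserial_iff
  proof (intro ballI)
    fix x y assume "x \<in> carrier M" "y \<in> carrier M"
    then show "(\<exists>a \<in> carrier R. x = a \<odot>\<^bsub>M\<^esub> y) \<or> (\<exists>a \<in> carrier R. y = a \<odot>\<^bsub>M\<^esub> x)"
      \<comment> \<open>With both first components zero, \<open>g\<close> contributes nothing and
        the multiplier acts on the second components through \<open>c\<close> alone.\<close>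
      using cmp[of \<zero> \<zero> x y] by auto
  qed
  have uniR: "uniserial R (self_module R)"
    unfolding S.uniserial_iff
  proof (intro ballI)
    fix x y assume "x \<in> carrier (self_module R)" "y \<in> carrier (self_module R)"
    then show "(\<exists>a \<in> carrier R. x = a \<odot>\<^bsub>self_module R\<^esub> y) \<or>
        (\<exists>a \<in> carrier R. y = a \<odot>\<^bsub>self_module R\<^esub> x)"
      using cmp[of x y "\<zero>\<^bsub>M\<^esub>" "\<zero>\<^bsub>M\<^esub>"] by auto
  qed
  show div: "divisible_module R M"
    unfolding divisible_module_def
  proof (intro ballI)
    fix a x assume "a \<in> carrier R - {\<zero>}" "x \<in> carrier M"
    then show "\<exists>y \<in> carrier M. x = a \<odot>\<^bsub>M\<^esub> y"
      \<comment> \<open>The pair \<open>(a, 0)\<close> is no multiple of \<open>(0, x)\<close>,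
        because \<open>a\<close> is nonzero. So \<open>(0, x)\<close> is a multiple of
        \<open>(a, 0)\<close>, and the second components read \<open>x = a g\<close>.\<close>
      using cmp[of a \<zero> "\<zero>\<^bsub>M\<^esub>" x] by auto
  qed
  have zero: "x = \<zero>\<^bsub>M\<^esub>" if "x \<in> carrier M" "\<one> = \<zero>" for x
    using that smult_one[of x] by simp
  have "domain R"
  proof (intro domain.intro domain_axioms.intro)
    show "\<one> \<noteq> \<zero>" using nz zero by blast
    fix a b assume ab: "a \<otimes> b = \<zero>" "a \<in> carrier R" "b \<in> carrier R"
    show "a = \<zero> \<or> b = \<zero>"
    proof (rule ccontr)
      assume n: "\<not> ?thesis"
      \<comment> \<open>If \<open>a\<close> and \<open>b\<close> were both nonzero, dividing
        \<open>x\<close> first by \<open>a\<close> and then by \<open>b\<close> would place it in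
        \<open>(ab) M = 0\<close>, against \<open>nz\<close>.\<close>
      have "x = \<zero>\<^bsub>M\<^esub>" if x: "x \<in> carrier M" for x
      proof -
        obtain y where y: "y \<in> carrier M" "x = a \<odot>\<^bsub>M\<^esub> y"
          using divisible_moduleD[OF div ab(2) _ x] n by blast
        obtain z where z: "z \<in> carrier M" "y = b \<odot>\<^bsub>M\<^esub> z"
          using divisible_moduleD[OF div ab(3) _ y(1)] n by blast
        have "x = (a \<otimes> b) \<odot>\<^bsub>M\<^esub> z" using y z ab(2,3) by (simp add: smult_assoc1)
        then show ?thesis using ab z by simp
      qed
      then show False using nz by blast
    qed
  qed (rule R.is_cring)
  then show "valuation_domain R"
    using uniR R.is_cring by (simp add: valuation_domain_def valuation_ring_def)
qed

text \<open>The multiplier is \<open>(c, g)\<close> with \<open>a g = f - c e\<close>, which is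
  solvable by divisibility. Thus a nonzero first component of the divisor leaves the second
  components unconstrained.\<close>

lemma idealization_multiple:
  assumes div: "divisible_module R M" and car: "a \<in> carrier R" "c \<in> carrier R"
    "e \<in> carrier M" "f \<in> carrier M" and a: "a \<noteq> \<zero>"
  shows "\<exists>r \<in> carrier (idealization R M). (c \<otimes> a, f) = r \<otimes>\<^bsub>idealization R M\<^esub> (a, e)"
proof -
  obtain g where g: "g \<in> carrier M" "f \<ominus>\<^bsub>M\<^esub> c \<odot>\<^bsub>M\<^esub> e = a \<odot>\<^bsub>M\<^esub> g"
    using divisible_moduleD[OF div car(1) a, of "f \<ominus>\<^bsub>M\<^esub> c \<odot>\<^bsub>M\<^esub> e"] car by auto
  have "c \<odot>\<^bsub>M\<^esub> e \<oplus>\<^bsub>M\<^esub> (f \<ominus>\<^bsub>M\<^esub> c \<odot>\<^bsub>M\<^esub> e) = f"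
    using car by (simp add: M.minus_eq M.a_lcomm M.r_neg)
  then show ?thesis
    using car g by (intro bexI[of _ "(c, g)"]) auto
qed

lemma valuation_ring_idealizationI:
  assumes val: "valuation_domain R" and uni: "uniserial R M" and div: "divisible_module R M"
  shows "valuation_ring (idealization R M)"
proof -
  interpret I: module "idealization R M" "self_module (idealization R M)"
    by (rule cring.module_self_module[OF cring_idealization])
  interpret S: module R "self_module R" by (rule module_self_module)
  have uniR: "uniserial R (self_module R)"
    using val by (simp add: valuation_domain_def valuation_ring_def)
  have cmp: "(\<exists>r \<in> carrier (idealization R M). (a, e) = r \<otimes>\<^bsub>idealization R M\<^esub> (b, f)) \<or>
      (\<exists>r \<in> carrier (idealization R M). (b, f) = r \<otimes>\<^bsub>idealization R M\<^esub> (a, e))"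
    if car: "a \<in> carrier R" "b \<in> carrier R" "e \<in> carrier M" "f \<in> carrier M" for a b e f
  \<comment> \<open>If both first components vanish, uniseriality of \<open>M\<close> compares the
    second ones, with multiplier \<open>(c, 0)\<close>. Otherwise the first components are compared
    in \<open>R\<close>, and the one acting as divisor is nonzero, since its multiple would vanish
    along with it.\<close>
  proof (cases "a = \<zero> \<and> b = \<zero>")
    case True
    from uni car(3,4) show ?thesis
    proof (cases rule: uniserialD)
      case (1 c)
      then have "(a, e) = (c, \<zero>\<^bsub>M\<^esub>) \<otimes>\<^bsub>idealization R M\<^esub> (b, f)" using True car by simp
      then show ?thesis using 1 by (intro disjI1 bexI[of _ "(c, \<zero>\<^bsub>M\<^esub>)"]) auto
    next
      case (2 c)
      then have "(b, f) = (c, \<zero>\<^bsub>M\<^esub>) \<otimes>\<^bsub>idealization R M\<^esub> (a, e)" using True car by simp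
      then show ?thesis using 2 by (intro disjI2 bexI[of _ "(c, \<zero>\<^bsub>M\<^esub>)"]) auto
    qed
  next
    case False
    have "a \<in> carrier (self_module R)" "b \<in> carrier (self_module R)" using car by auto
    from uniR this show ?thesis
    proof (cases rule: S.uniserialD)
      case (1 c)
      then have "a = c \<otimes> b" "b \<noteq> \<zero>" using False car by auto
      then show ?thesis using idealization_multiple[OF div, of b c f e] 1 car by simp
    next
      case (2 c)
      then have "b = c \<otimes> a" "a \<noteq> \<zero>" using False car by auto
      then show ?thesis using idealization_multiple[OF div, of a c e f] 2 car by simp
    qed
  qed
  have "uniserial (idealization R M) (self_module (idealization R M))"
    \<comment> \<open>The product formula stays folded, so that the goal keeps the shape of
      \<open>cmp\<close>.\<close>
    unfolding I.uniserial_iff using cmp by (simp del: idealization_simps(2))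
  then show ?thesis using cring_idealization by (simp add: valuation_ring_def)
qed

lemma valuation_ring_idealization_iff:
  assumes "carrier M \<noteq> {\<zero>\<^bsub>M\<^esub>}"
  shows "valuation_ring (idealization R M) \<longleftrightarrow>
    valuation_domain R \<and> uniserial R M \<and> divisible_module R M"
  using valuation_ring_idealizationD[OF assms] valuation_ring_idealizationI by blast

end

section \<open>Transport of uniseriality and divisibility along isomorphisms\<close>

lemma module_isomorphicE:
  assumes "module_isomorphic A M N"
  obtains h where "bij_betw h (carrier M) (carrier N)"
    and "\<And>x y. \<lbrakk>x \<in> carrier M; y \<in> carrier M\<rbrakk> \<Longrightarrow> h (x \<oplus>\<^bsub>M\<^esub> y) = h x \<oplus>\<^bsub>N\<^esub> h y"
    and "\<And>a x. \<lbrakk>a \<in> carrier A; x \<in> carrier M\<rbrakk> \<Longrightarrow> h (a \<odot>\<^bsub>M\<^esub> x) = a \<odot>\<^bsub>N\<^esub> h x"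
  using assms unfolding module_isomorphic_def module_hom_def by blast

lemma module_isomorphic_sym:
  assumes M: "module A M" and iso: "module_isomorphic A M N"
  shows "module_isomorphic A N M"
proof -
  interpret module A M by (rule M)
  from iso obtain h where bij: "bij_betw h (carrier M) (carrier N)"
    and add: "\<And>x y. \<lbrakk>x \<in> carrier M; y \<in> carrier M\<rbrakk> \<Longrightarrow> h (x \<oplus>\<^bsub>M\<^esub> y) = h x \<oplus>\<^bsub>N\<^esub> h y"
    and smult: "\<And>a x. \<lbrakk>a \<in> carrier A; x \<in> carrier M\<rbrakk> \<Longrightarrow> h (a \<odot>\<^bsub>M\<^esub> x) = a \<odot>\<^bsub>N\<^esub> h x"
    by (rule module_isomorphicE) blast
  define g where "g = inv_into (carrier M) h"
  have gh: "g (h x) = x" if "x \<in> carrier M" for x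
    using that bij by (simp add: g_def bij_betw_inv_into_left)
  have N: "carrier N = h ` carrier M" using bij by (simp add: bij_betw_def)
  \<comment> \<open>Elements of \<open>N\<close> are written as \<open>h x\<close>. Sums and
    multiples are first pulled inside \<open>h\<close>, where \<open>gh\<close> cancels.\<close>
  have "g \<in> module_hom A N M"
    unfolding module_hom_def by (auto simp: N gh add[symmetric] smult[symmetric])
  moreover have "bij_betw g (carrier N) (carrier M)"
    unfolding g_def by (rule bij_betw_inv_into[OF bij])
  ultimately show ?thesis unfolding module_isomorphic_def by blast
qed

lemma uniserial_isomorphic:
  assumes M: "module A M" and N: "module A N" and iso: "module_isomorphic A M N"
    and uni: "uniserial A M"
  shows "uniserial A N"
proof -
  interpret M: module A M by (rule M)
  interpret N: module A N by (rule N)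
  from iso obtain h where bij: "bij_betw h (carrier M) (carrier N)"
    and smult: "\<And>a x. \<lbrakk>a \<in> carrier A; x \<in> carrier M\<rbrakk> \<Longrightarrow> h (a \<odot>\<^bsub>M\<^esub> x) = a \<odot>\<^bsub>N\<^esub> h x"
    by (rule module_isomorphicE) blast
  have carN: "carrier N = h ` carrier M" using bij by (simp add: bij_betw_def)
  show ?thesis
    unfolding N.uniserial_iff carN
  proof (clarify)
    fix x y
    assume x: "x \<in> carrier M" and y: "y \<in> carrier M"
      and no: "\<not> (\<exists>a \<in> carrier A. h y = a \<odot>\<^bsub>N\<^esub> h x)"
    from uni x y show "\<exists>a \<in> carrier A. h x = a \<odot>\<^bsub>N\<^esub> h y"
      by (cases rule: M.uniserialD) (use x y no smult in auto)
  qed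
qed

lemma divisible_isomorphic:
  assumes iso: "module_isomorphic A M N" and div: "divisible_module A M"
  shows "divisible_module A N"
proof -
  from iso obtain h where bij: "bij_betw h (carrier M) (carrier N)"
    and smult: "\<And>a x. \<lbrakk>a \<in> carrier A; x \<in> carrier M\<rbrakk> \<Longrightarrow> h (a \<odot>\<^bsub>M\<^esub> x) = a \<odot>\<^bsub>N\<^esub> h x"
    by (rule module_isomorphicE) blast
  have carN: "carrier N = h ` carrier M" using bij by (simp add: bij_betw_def)
  show ?thesis
    unfolding divisible_module_def carN
  proof (clarify)
    fix a x assume a: "a \<in> carrier A" "a \<noteq> \<zero>\<^bsub>A\<^esub>" and x: "x \<in> carrier M"
    from div a x obtain y where "y \<in> carrier M" "x = a \<odot>\<^bsub>M\<^esub> y"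
      by (rule divisible_moduleD)
    then show "\<exists>y \<in> h ` carrier M. h x = a \<odot>\<^bsub>N\<^esub> y" using a smult by auto
  qed
qed

section \<open>The model modules: the field of fractions, and a field over itself\<close>

lemma (in domain) module_frac_field: "module R (frac_field R)"
  by (rule algebra.module[OF algebra_frac_field])

lemma (in domain) divisible_frac_field: "divisible_module R (frac_field R)"
  unfolding divisible_module_def
proof (intro ballI)
  fix a x assume a: "a \<in> carrier R - {\<zero>}" and "x \<in> carrier (frac_field R)"
  then obtain b s where x: "x = frac R b s" "b \<in> carrier R" "s \<in> carrier R" "s \<noteq> \<zero>"
    by (auto simp: carrier_frac_field)
  then have "x = a \<odot>\<^bsub>frac_field R\<^esub> frac R b (s \<otimes> a)"
    using a by (simp add: smult_frac_field integral_iff frac_eq_iff m_ac)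
  moreover have "frac R b (s \<otimes> a) \<in> carrier (frac_field R)"
    using a x by (intro in_frac_field) (auto simp: integral_iff)
  ultimately show "\<exists>y \<in> carrier (frac_field R). x = a \<odot>\<^bsub>frac_field R\<^esub> y" by blast
qed

text \<open>Over the common denominator \<open>s t\<close>, the fractions \<open>a/s\<close> and
  \<open>b/t\<close> have numerators \<open>a t\<close> and \<open>b s\<close>. A comparison of
  these in \<open>A\<close> carries over to the fractions with the same multiplier.\<close>

lemma uniserial_frac_field:
  assumes val: "valuation_domain A"
  shows "uniserial A (frac_field A)"
proof -
  interpret domain A using val by (simp add: valuation_domain_def)
  interpret K: module A "frac_field A" by (rule module_frac_field)
  interpret S: module A "self_module A" by (rule module_self_module)
  have uni: "uniserial A (self_module A)"
    using val by (simp add: valuation_domain_def valuation_ring_def)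
  show ?thesis
    unfolding K.uniserial_iff
  proof (intro ballI)
    fix x y assume "x \<in> carrier (frac_field A)" "y \<in> carrier (frac_field A)"
    then obtain a s b t where xy: "x = frac A a s" "y = frac A b t"
      and car: "a \<in> carrier A" "s \<in> carrier A" "s \<noteq> \<zero>\<^bsub>A\<^esub>" "b \<in> carrier A" "t \<in> carrier A" "t \<noteq> \<zero>\<^bsub>A\<^esub>"
      by (auto simp: carrier_frac_field)
    have "a \<otimes>\<^bsub>A\<^esub> t \<in> carrier (self_module A)" "b \<otimes>\<^bsub>A\<^esub> s \<in> carrier (self_module A)"
      using car by auto
    from uni this show "(\<exists>c \<in> carrier A. x = c \<odot>\<^bsub>frac_field A\<^esub> y) \<or>
        (\<exists>c \<in> carrier A. y = c \<odot>\<^bsub>frac_field A\<^esub> x)"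
    proof (cases rule: S.uniserialD)
      case (1 c)
      then have "x = c \<odot>\<^bsub>frac_field A\<^esub> y"
        using car by (simp add: xy smult_frac_field frac_eq_iff m_assoc)
      then show ?thesis using 1 by blast
    next
      case (2 c)
      then have "y = c \<odot>\<^bsub>frac_field A\<^esub> x"
        using car by (simp add: xy smult_frac_field frac_eq_iff m_assoc)
      then show ?thesis using 2 by blast
    qed
  qed
qed

lemma (in field) divisible_self_module: "divisible_module R (self_module R)"
  unfolding divisible_module_def
proof (intro ballI)
  fix a x assume a: "a \<in> carrier R - {\<zero>}" and x: "x \<in> carrier (self_module R)"
  then have "a \<in> Units R" by (simp add: field_Units)
  then have "x = a \<otimes> (inv a \<otimes> x)" "inv a \<otimes> x \<in> carrier R"
    using a x by (simp_all add: m_assoc[symmetric])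
  then show "\<exists>y \<in> carrier (self_module R). x = a \<odot>\<^bsub>self_module R\<^esub> y" by auto
qed

lemma (in field) valuation_domain_field: "valuation_domain R"
proof -
  interpret S: module R "self_module R" by (rule module_self_module)
  have "uniserial R (self_module R)"
    unfolding S.uniserial_iff
  proof (intro ballI)
    fix x y assume xy: "x \<in> carrier (self_module R)" "y \<in> carrier (self_module R)"
    show "(\<exists>a \<in> carrier R. x = a \<odot>\<^bsub>self_module R\<^esub> y) \<or>
        (\<exists>a \<in> carrier R. y = a \<odot>\<^bsub>self_module R\<^esub> x)"
    proof (cases "x = \<zero>")
      case True
      then show ?thesis using xy by (intro disjI1 bexI[of _ \<zero>]) auto
    next
      case False
      then obtain z where "z \<in> carrier R" "y = x \<otimes> z"
        using divisible_moduleD[OF divisible_self_module, of x y] xy by auto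
      then show ?thesis using xy by (intro disjI2 bexI[of _ z]) (auto simp: m_comm)
    qed
  qed
  then show ?thesis
    using is_cring domain_axioms by (simp add: valuation_domain_def valuation_ring_def)
qed

section \<open>Divisible modules over a domain: the non-torsion and the cyclic case\<close>

context module
begin

text \<open>The difference \<open>a - b\<close> annihilates \<open>u\<close>.\<close>

lemma smult_cancel_zero_annihilator:
  assumes u: "u \<in> carrier M" "\<And>a. \<lbrakk>a \<in> carrier R; a \<odot>\<^bsub>M\<^esub> u = \<zero>\<^bsub>M\<^esub>\<rbrakk> \<Longrightarrow> a = \<zero>"
    and ab: "a \<in> carrier R" "b \<in> carrier R" "a \<odot>\<^bsub>M\<^esub> u = b \<odot>\<^bsub>M\<^esub> u"
  shows "a = b"
proof -
  have "(a \<ominus> b) \<odot>\<^bsub>M\<^esub> u = \<zero>\<^bsub>M\<^esub>"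
    using u(1) ab by (simp add: R.minus_eq smult_l_distr smult_l_minus M.r_neg)
  then have "a \<ominus> b = \<zero>" using u(2) ab by simp
  then show ?thesis using ab by (simp add: R.minus_eq_zero_iff)
qed

lemma smult_swap:
  assumes "a \<in> carrier R" "b \<in> carrier R" "x \<in> carrier M"
  shows "a \<odot>\<^bsub>M\<^esub> (b \<odot>\<^bsub>M\<^esub> x) = b \<odot>\<^bsub>M\<^esub> (a \<odot>\<^bsub>M\<^esub> x)"
  using assms by (metis smult_assoc1 R.m_comm)

text \<open>Each hypothesis pays for one property of the map sending \<open>x\<close> to
  \<open>a/s\<close> when \<open>s x = a u\<close>. Uniseriality provides \<open>a\<close> and
  \<open>s\<close>, the zero annihilator of \<open>u\<close> makes the fraction well defined,
  torsion-freeness gives injectivity, and divisibility gives surjectivity.\<close>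

lemma isomorphic_frac_field:
  assumes dom: "domain R" and uni: "uniserial R M" and div: "divisible_module R M"
    and tor: "\<not> torsion_module R M"
  shows "module_isomorphic R M (frac_field R)"
proof -
  interpret domain R by (rule dom)
  let ?K = "frac_field R"
  obtain u where u: "u \<in> carrier M"
    and ann: "\<And>a. \<lbrakk>a \<in> carrier R; a \<odot>\<^bsub>M\<^esub> u = \<zero>\<^bsub>M\<^esub>\<rbrakk> \<Longrightarrow> a = \<zero>"
    using tor unfolding torsion_module_def by blast
  have u0: "u \<noteq> \<zero>\<^bsub>M\<^esub>" using ann[of \<one>] u by auto
  \<comment> \<open>One element with zero annihilator makes the whole uniserial module torsion-free.
    If \<open>x = a u\<close>, then \<open>s a\<close> kills \<open>u\<close>, so
    \<open>a = 0\<close>; if \<open>u = a x\<close>, then \<open>s\<close> itself kills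
    \<open>u\<close>, which is impossible.\<close>
  have torsionfree: "x = \<zero>\<^bsub>M\<^esub>"
    if x: "x \<in> carrier M" and s: "s \<in> carrier R" "s \<noteq> \<zero>" and sx: "s \<odot>\<^bsub>M\<^esub> x = \<zero>\<^bsub>M\<^esub>" for x s
    using uni x u
  proof (cases rule: uniserialD)
    case (1 a)
    then have "(s \<otimes> a) \<odot>\<^bsub>M\<^esub> u = \<zero>\<^bsub>M\<^esub>" using s sx u by (simp add: smult_assoc1)
    then have "a = \<zero>" using ann[of "s \<otimes> a"] s 1 by (simp add: integral_iff)
    then show ?thesis using 1 u by simp
  next
    case (2 a)
    then have "s \<odot>\<^bsub>M\<^esub> u = a \<odot>\<^bsub>M\<^esub> (s \<odot>\<^bsub>M\<^esub> x)" using s x by (simp add: smult_swap)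
    then have "s = \<zero>" using ann[of s] s sx 2 by simp
    then show ?thesis using s by simp
  qed
  have cancel: "x = y"
    if "x \<in> carrier M" "y \<in> carrier M" "s \<in> carrier R" "s \<noteq> \<zero>" "s \<odot>\<^bsub>M\<^esub> x = s \<odot>\<^bsub>M\<^esub> y" for x y s
  proof -
    have "s \<odot>\<^bsub>M\<^esub> (x \<ominus>\<^bsub>M\<^esub> y) = \<zero>\<^bsub>M\<^esub>"
      using that by (simp add: M.minus_eq smult_r_distr smult_r_minus M.r_neg)
    then have "x \<ominus>\<^bsub>M\<^esub> y = \<zero>\<^bsub>M\<^esub>" using torsionfree[of "x \<ominus>\<^bsub>M\<^esub> y" s] that by simp
    then show ?thesis using that by (simp add: M.minus_eq_zero_iff)
  qed
  \<comment> \<open>The pair holds numerator and denominator: \<open>x = a u\<close> gives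
    \<open>a/1\<close>, and \<open>u = a x\<close> gives \<open>1/a\<close>, where \<open>a\<close>
    is nonzero because \<open>u\<close> is.\<close>
  have "\<exists>p. fst p \<in> carrier R \<and> snd p \<in> carrier R - {\<zero>} \<and> snd p \<odot>\<^bsub>M\<^esub> x = fst p \<odot>\<^bsub>M\<^esub> u"
    if x: "x \<in> carrier M" for x
    using uni x u
  proof (cases rule: uniserialD)
    case (1 a)
    then show ?thesis using x by (intro exI[of _ "(a, \<one>)"]) auto
  next
    case (2 a)
    then have "a \<noteq> \<zero>" using u0 x by auto
    then show ?thesis using 2 u by (intro exI[of _ "(\<one>, a)"]) auto
  qed
  then obtain p where p: "\<And>x. x \<in> carrier M \<Longrightarrow>
      fst (p x) \<in> carrier R \<and> snd (p x) \<in> carrier R - {\<zero>} \<and>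
      snd (p x) \<odot>\<^bsub>M\<^esub> x = fst (p x) \<odot>\<^bsub>M\<^esub> u"
    by metis
  define h where "h x = frac R (fst (p x)) (snd (p x))" for x
  have rep: "\<exists>a s. a \<in> carrier R \<and> s \<in> carrier R - {\<zero>} \<and> s \<odot>\<^bsub>M\<^esub> x = a \<odot>\<^bsub>M\<^esub> u \<and> h x = frac R a s"
    if "x \<in> carrier M" for x
    using p[OF that] unfolding h_def by blast
  have h_closed: "h x \<in> carrier ?K" if "x \<in> carrier M" for x
    using rep[OF that] by (auto intro: in_frac_field)
  \<comment> \<open>The choice made by \<open>p\<close> is immaterial: any relation
    \<open>t x = b u\<close> computes \<open>h x\<close>. Indeed
    \<open>t a u = t s x = s b u\<close>, and \<open>u\<close> can be cancelled.\<close>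
  have h_eq: "h x = frac R b t"
    if x: "x \<in> carrier M" and b: "b \<in> carrier R" and t: "t \<in> carrier R" "t \<noteq> \<zero>"
      and tx: "t \<odot>\<^bsub>M\<^esub> x = b \<odot>\<^bsub>M\<^esub> u" for x b t
  proof -
    obtain a s where a: "a \<in> carrier R" "s \<in> carrier R - {\<zero>}" "s \<odot>\<^bsub>M\<^esub> x = a \<odot>\<^bsub>M\<^esub> u"
      and h: "h x = frac R a s"
      using rep[OF x] by blast
    have "(t \<otimes> a) \<odot>\<^bsub>M\<^esub> u = t \<odot>\<^bsub>M\<^esub> (s \<odot>\<^bsub>M\<^esub> x)" using a t u by (simp add: smult_assoc1)
    also have "\<dots> = s \<odot>\<^bsub>M\<^esub> (t \<odot>\<^bsub>M\<^esub> x)" using a(2) t(1) x by (intro smult_swap) auto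
    also have "\<dots> = (s \<otimes> b) \<odot>\<^bsub>M\<^esub> u" unfolding tx using a b u by (simp add: smult_assoc1)
    finally have "t \<otimes> a = s \<otimes> b"
      using smult_cancel_zero_annihilator[OF u ann, of "t \<otimes> a" "s \<otimes> b"] a b t by simp
    then show ?thesis unfolding h using a b t by (simp add: frac_eq_iff m_comm)
  qed
  have "h \<in> module_hom R M ?K"
    unfolding module_hom_def
  proof (intro CollectI conjI Pi_I ballI)
    fix x assume "x \<in> carrier M"
    then show "h x \<in> carrier ?K" by (rule h_closed)
  next
    fix x y assume x: "x \<in> carrier M" and y: "y \<in> carrier M"
    obtain a s where a: "a \<in> carrier R" "s \<in> carrier R - {\<zero>}" "s \<odot>\<^bsub>M\<^esub> x = a \<odot>\<^bsub>M\<^esub> u" "h x = frac R a s"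
      using rep[OF x] by blast
    obtain b t where b: "b \<in> carrier R" "t \<in> carrier R - {\<zero>}" "t \<odot>\<^bsub>M\<^esub> y = b \<odot>\<^bsub>M\<^esub> u" "h y = frac R b t"
      using rep[OF y] by blast
    have "(s \<otimes> t) \<odot>\<^bsub>M\<^esub> (x \<oplus>\<^bsub>M\<^esub> y) = t \<odot>\<^bsub>M\<^esub> (s \<odot>\<^bsub>M\<^esub> x) \<oplus>\<^bsub>M\<^esub> s \<odot>\<^bsub>M\<^esub> (t \<odot>\<^bsub>M\<^esub> y)"
      using a(2) b(2) x y by (simp add: smult_r_distr smult_assoc1 smult_swap[of s t x])
    also have "\<dots> = (a \<otimes> t \<oplus> b \<otimes> s) \<odot>\<^bsub>M\<^esub> u"
      unfolding a(3) b(3) using a(1,2) b(1,2) u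
      by (simp add: smult_l_distr smult_assoc1[symmetric] m_comm)
    finally have "h (x \<oplus>\<^bsub>M\<^esub> y) = frac R (a \<otimes> t \<oplus> b \<otimes> s) (s \<otimes> t)"
      using a b x y by (intro h_eq) (auto simp: integral_iff)
    then show "h (x \<oplus>\<^bsub>M\<^esub> y) = h x \<oplus>\<^bsub>?K\<^esub> h y"
      using a b by (simp add: add_frac_field)
  next
    fix c x assume c: "c \<in> carrier R" and x: "x \<in> carrier M"
    obtain a s where a: "a \<in> carrier R" "s \<in> carrier R - {\<zero>}" "s \<odot>\<^bsub>M\<^esub> x = a \<odot>\<^bsub>M\<^esub> u" "h x = frac R a s"
      using rep[OF x] by blast
    have "s \<odot>\<^bsub>M\<^esub> (c \<odot>\<^bsub>M\<^esub> x) = (c \<otimes> a) \<odot>\<^bsub>M\<^esub> u"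
      using a c x u by (simp add: smult_swap[of s c x] smult_assoc1)
    then have "h (c \<odot>\<^bsub>M\<^esub> x) = frac R (c \<otimes> a) s"
      using a c x by (intro h_eq) auto
    then show "h (c \<odot>\<^bsub>M\<^esub> x) = c \<odot>\<^bsub>?K\<^esub> h x" using a c by (simp add: smult_frac_field)
  qed
  moreover have "bij_betw h (carrier M) (carrier ?K)"
  proof (rule bij_betw_imageI)
    show "inj_on h (carrier M)"
    proof (rule inj_onI)
      fix x y assume x: "x \<in> carrier M" and y: "y \<in> carrier M" and eq: "h x = h y"
      obtain a s where a: "a \<in> carrier R" "s \<in> carrier R - {\<zero>}" "s \<odot>\<^bsub>M\<^esub> x = a \<odot>\<^bsub>M\<^esub> u" "h x = frac R a s"
        using rep[OF x] by blast
      obtain b t where b: "b \<in> carrier R" "t \<in> carrier R - {\<zero>}" "t \<odot>\<^bsub>M\<^esub> y = b \<odot>\<^bsub>M\<^esub> u" "h y = frac R b t"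
        using rep[OF y] by blast
      \<comment> \<open>Equality of the two fractions gives
        \<open>s t x = a t u = b s u = s t y\<close>, and the nonzero scalar \<open>s t\<close> is
        then cancelled.\<close>
      have ab: "a \<otimes> t = b \<otimes> s" using eq a b by (simp add: frac_eq_iff)
      have "(s \<otimes> t) \<odot>\<^bsub>M\<^esub> x = t \<odot>\<^bsub>M\<^esub> (s \<odot>\<^bsub>M\<^esub> x)"
        using a(2) b(2) x by (simp add: smult_assoc1 smult_swap[of s t x])
      also have "\<dots> = (a \<otimes> t) \<odot>\<^bsub>M\<^esub> u"
        unfolding a(3) using a(1) b(2) u by (simp add: smult_assoc1[symmetric] m_comm)
      also have "\<dots> = s \<odot>\<^bsub>M\<^esub> (t \<odot>\<^bsub>M\<^esub> y)"
        unfolding ab b(3) using a(2) b(1) u by (simp add: smult_assoc1[symmetric] m_comm)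
      also have "\<dots> = (s \<otimes> t) \<odot>\<^bsub>M\<^esub> y" using a(2) b(2) y by (simp add: smult_assoc1)
      finally show "x = y"
        using a b x y by (intro cancel[of x y "s \<otimes> t"]) (auto simp: integral_iff)
    qed
    show "h ` carrier M = carrier ?K"
    proof
      show "h ` carrier M \<subseteq> carrier ?K"
        using h_closed by blast
      show "carrier ?K \<subseteq> h ` carrier M"
      proof
        fix z assume "z \<in> carrier ?K"
        then obtain a s where z: "z = frac R a s" "a \<in> carrier R" "s \<in> carrier R" "s \<noteq> \<zero>"
          by (auto simp: carrier_frac_field)
        \<comment> \<open>Dividing \<open>a u\<close> by \<open>s\<close> yields a preimage of
          \<open>a/s\<close>.\<close>
        obtain x where "x \<in> carrier M" "a \<odot>\<^bsub>M\<^esub> u = s \<odot>\<^bsub>M\<^esub> x"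
          using divisible_moduleD[OF div z(3,4), of "a \<odot>\<^bsub>M\<^esub> u"] z(2) u by blast
        moreover from this have "h x = z" unfolding z(1) using z by (intro h_eq) auto
        ultimately show "z \<in> h ` carrier M" by blast
      qed
    qed
  qed
  ultimately show ?thesis unfolding module_isomorphic_def by blast
qed

text \<open>Divisibility forces the annihilator of the generator \<open>u\<close> to vanish, so
  scalars can be compared by their action on \<open>u\<close>. This yields both the inverses in
  \<open>R\<close> and the injectivity of the map sending \<open>a\<close> to
  \<open>a u\<close>.\<close>

lemma divisible_cyclic:
  assumes dom: "domain R" and div: "divisible_module R M" and nz: "carrier M \<noteq> {\<zero>\<^bsub>M\<^esub>}"
    and u: "u \<in> carrier M" and gen: "carrier M = (\<lambda>a. a \<odot>\<^bsub>M\<^esub> u) ` carrier R"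
  shows "field R" "module_isomorphic R M (self_module R)"
proof -
  interpret domain R by (rule dom)
  have u0: "u \<noteq> \<zero>\<^bsub>M\<^esub>" using nz gen by force
  \<comment> \<open>If a nonzero \<open>d\<close> kills \<open>u\<close>, write
    \<open>u = d g\<close> and \<open>g = c u\<close>; then \<open>u = c (d u) = 0\<close>.\<close>
  have ann: "d = \<zero>" if d: "d \<in> carrier R" "d \<odot>\<^bsub>M\<^esub> u = \<zero>\<^bsub>M\<^esub>" for d
  proof (rule ccontr)
    assume "d \<noteq> \<zero>"
    then obtain g where g: "g \<in> carrier M" "u = d \<odot>\<^bsub>M\<^esub> g"
      using divisible_moduleD[OF div d(1) _ u] by blast
    from g(1) obtain c where c: "c \<in> carrier R" "g = c \<odot>\<^bsub>M\<^esub> u" unfolding gen by blast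
    note g(2)[unfolded c(2)]
    also have "d \<odot>\<^bsub>M\<^esub> (c \<odot>\<^bsub>M\<^esub> u) = c \<odot>\<^bsub>M\<^esub> (d \<odot>\<^bsub>M\<^esub> u)" using d(1) c(1) u by (rule smult_swap)
    also have "\<dots> = \<zero>\<^bsub>M\<^esub>" using d(2) c(1) by simp
    finally show False using u0 by contradiction
  qed
  show "field R"
  proof (rule cring_fieldI2)
    fix a assume a: "a \<in> carrier R" "a \<noteq> \<zero>"
    obtain g where g: "g \<in> carrier M" "u = a \<odot>\<^bsub>M\<^esub> g"
      using divisible_moduleD[OF div a u] by blast
    from g(1) obtain c where c: "c \<in> carrier R" "g = c \<odot>\<^bsub>M\<^esub> u" unfolding gen by blast
    \<comment> \<open>Here \<open>(a c) u = a g = u\<close>, so cancelling \<open>u\<close> makes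
      \<open>c\<close> the inverse of \<open>a\<close>.\<close>
    have "(a \<otimes> c) \<odot>\<^bsub>M\<^esub> u = a \<odot>\<^bsub>M\<^esub> g"
      unfolding c(2) using a(1) c(1) u by (rule smult_assoc1)
    then have "(a \<otimes> c) \<odot>\<^bsub>M\<^esub> u = \<one> \<odot>\<^bsub>M\<^esub> u"
      unfolding g(2)[symmetric] using u by simp
    then have "a \<otimes> c = \<one>"
      using smult_cancel_zero_annihilator[OF u ann, of "a \<otimes> c" \<one>] a c by simp
    then show "\<exists>b \<in> carrier R. a \<otimes> b = \<one>" using c by blast
  qed simp
  \<comment> \<open>The isomorphism is built from \<open>R\<close> to \<open>M\<close>, where it has
    an explicit formula, and is inverted at the end.\<close>
  have "(\<lambda>a. a \<odot>\<^bsub>M\<^esub> u) \<in> module_hom R (self_module R) M"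
    unfolding module_hom_def using u by (auto simp: smult_l_distr smult_assoc1)
  moreover have "bij_betw (\<lambda>a. a \<odot>\<^bsub>M\<^esub> u) (carrier (self_module R)) (carrier M)"
    unfolding bij_betw_def
  proof
    show "inj_on (\<lambda>a. a \<odot>\<^bsub>M\<^esub> u) (carrier (self_module R))"
      by (rule inj_onI) (auto intro: smult_cancel_zero_annihilator[OF u ann])
  qed (simp add: gen)
  ultimately have "module_isomorphic R (self_module R) M"
    unfolding module_isomorphic_def by blast
  then show "module_isomorphic R M (self_module R)"
    by (rule module_isomorphic_sym[OF module_self_module])
qed

end

theorem theorem2p1:
  fixes A :: "('a, 'm) ring_scheme" and E :: "('a, 'b, 'n) module_scheme"
  assumes "module A E" and "carrier E \<noteq> {\<zero>\<^bsub>E\<^esub>}"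
  shows "(\<not> torsion_module A E \<longrightarrow>
      (valuation_ring (idealization A E) \<longleftrightarrow>
        valuation_domain A \<and> module_isomorphic A E (frac_field A))) \<and>
    (fin_gen_module A E \<longrightarrow>
      (valuation_ring (idealization A E) \<longleftrightarrow>
        field A \<and> module_isomorphic A E (self_module A)))"
proof -
  interpret module A E by (rule assms(1))
  note val_iff = valuation_ring_idealization_iff[OF assms(2)]
  \<comment> \<open>The type of \<open>N\<close> is left general, since the fact serves both models
    \<open>frac_field A\<close> and \<open>self_module A\<close>. The isomorphism is reversed so
    that properties pass from the model to \<open>E\<close>.\<close>
  have transfer: "uniserial A E \<and> divisible_module A E"
    if "module A N" "module_isomorphic A E N" "uniserial A N" "divisible_module A N"
    for N :: "('a, 'x) module"
    using that module_isomorphic_sym[OF assms(1) that(2)]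
      uniserial_isomorphic[OF that(1) assms(1)] divisible_isomorphic by blast
  show ?thesis
  proof (intro conjI impI)
    assume tor: "\<not> torsion_module A E"
    show "valuation_ring (idealization A E) \<longleftrightarrow>
        valuation_domain A \<and> module_isomorphic A E (frac_field A)"
    proof
      assume "valuation_ring (idealization A E)"
      then show "valuation_domain A \<and> module_isomorphic A E (frac_field A)"
        using val_iff isomorphic_frac_field tor by (auto simp: valuation_domain_def)
    next
      assume r: "valuation_domain A \<and> module_isomorphic A E (frac_field A)"
      then have "domain A" by (simp add: valuation_domain_def)
      then show "valuation_ring (idealization A E)"
        using r val_iff transfer[of "frac_field A"] domain.module_frac_field
          domain.divisible_frac_field uniserial_frac_field by blast
    qed
  next
    assume fg: "fin_gen_module A E"
    show "valuation_ring (idealization A E) \<longleftrightarrow>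
        field A \<and> module_isomorphic A E (self_module A)"
    proof
      assume "valuation_ring (idealization A E)"
      then have v: "valuation_domain A" "uniserial A E" "divisible_module A E"
        using val_iff by auto
      obtain u where "u \<in> carrier E" "carrier E = (\<lambda>a. a \<odot>\<^bsub>E\<^esub> u) ` carrier A"
        using uniserial_fin_gen_cyclic[OF v(2) fg] by blast
      then show "field A \<and> module_isomorphic A E (self_module A)"
        using divisible_cyclic[OF _ v(3) assms(2)] v(1) by (auto simp: valuation_domain_def)
    next
      assume r: "field A \<and> module_isomorphic A E (self_module A)"
      then interpret F: field A by simp
      have "uniserial A (self_module A)"
        using F.valuation_domain_field by (simp add: valuation_domain_def valuation_ring_def)
      then show "valuation_ring (idealization A E)"
        using r val_iff transfer[of "self_module A"] R.module_self_module
          F.divisible_self_module F.valuation_domain_field by blast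
    qed
  qed
qed

end
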